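(* Let $X$ and $Y$ be metric spaces, let $x_0\in X$, let $c>0$, and let $f:X\to Y$ be a mapping which is locally injective at $x_0$. Then $f$ is strongly $c$-co-Lipschitz at $x_0$ if and only if $f$ is pointwise $c$-co-Lipschitz at $x_0$.
   Context: $B^Z_s(z)$ denotes the open ball of radius $s>0$ centred at $z$ in the metric space $Z$; $\mathrm{Int}$ denotes topological interior. A mapping $f:(X,d_X)\to (Y,d_Y)$ is locally injective at $x_0$ if there is $r>0$ such that the restriction of $f$ to $B^X_r(x_0)$ is injective. $f$ is pointwise $c$-co-Lipschitz at $x_0$ if there is $r_0>0$ such that $B^Y_{cr}(f(x_0))\subseteq f(B^X_r(x_0))$ for all $r\in(0,r_0)$. $f$ is strongly $c$-co-Lipschitz at $x_0$ if there is $\rho>0$ such that (i) $f(x_0)\in\mathrm{Int}\left(f(B^X_\rho(x_0))\right)$ and (ii) $d_Y(f(x),f(x_0))\ge c\,d_X(x,x_0)$ for all $x\in B^X_\rho(x_0)$. *)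

theory Defs
  imports "HOL-Analysis.Analysis"
begin

definition locally_injective_at :: "('a::metric_space \<Rightarrow> 'b) \<Rightarrow> 'a \<Rightarrow> bool" where
  "locally_injective_at f x0 \<longleftrightarrow> (\<exists>r>0. inj_on f (ball x0 r))"

definition pointwise_co_lipschitz_at ::
    "real \<Rightarrow> ('a::metric_space \<Rightarrow> 'b::metric_space) \<Rightarrow> 'a \<Rightarrow> bool" where
  "pointwise_co_lipschitz_at c f x0 \<longleftrightarrow>
     (\<exists>r0>0. \<forall>r\<in>{0<..<r0}. ball (f x0) (c * r) \<subseteq> f ` ball x0 r)"

definition strongly_co_lipschitz_at ::
    "real \<Rightarrow> ('a::metric_space \<Rightarrow> 'b::metric_space) \<Rightarrow> 'a \<Rightarrow> bool" where
  "strongly_co_lipschitz_at c f x0 \<longleftrightarrow>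
     (\<exists>\<rho>>0. f x0 \<in> interior (f ` ball x0 \<rho>) \<and>
            (\<forall>x\<in>ball x0 \<rho>. dist (f x) (f x0) \<ge> c * dist x x0))"

end

theory Submission
  imports Defs
begin

text \<open>
  Both properties describe the small balls around \<open>x0\<close>. The lower bound
  \<open>c * dist x x0 \<le> dist (f x) (f x0)\<close> says that preimages of points close to \<open>f x0\<close> are
  correspondingly close to \<open>x0\<close>, which upgrades the single inclusion given by the interior
  condition to a linear one at every small scale. Conversely, if the bound failed at some \<open>x\<close>, the
  inclusion at the scale \<open>r = dist x x0\<close> would produce a second preimage of \<open>f x\<close> strictly closer
  to \<open>x0\<close>, which local injectivity forbids.
\<close>

lemma strongly_imp_pointwise_co_lipschitz_at:
  assumes "c > 0" and "strongly_co_lipschitz_at c f x0"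
  shows "pointwise_co_lipschitz_at c f x0"
proof -
  obtain \<rho> where int: "f x0 \<in> interior (f ` ball x0 \<rho>)"
    and lower: "\<And>x. x \<in> ball x0 \<rho> \<Longrightarrow> c * dist x x0 \<le> dist (f x) (f x0)"
    using assms(2) by (auto simp: strongly_co_lipschitz_at_def)
  obtain \<delta> where "\<delta> > 0" and \<delta>: "ball (f x0) \<delta> \<subseteq> f ` ball x0 \<rho>"
    using int by (auto simp: mem_interior)
  have "ball (f x0) (c * r) \<subseteq> f ` ball x0 r" if r: "r \<in> {0<..<\<delta> / c}" for r
  proof
    fix y assume y: "y \<in> ball (f x0) (c * r)"
    have "c * r < \<delta>"
      using r \<open>c > 0\<close> by (simp add: field_simps)
    with y have "y \<in> ball (f x0) \<delta>"
      by simp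
    with \<delta> obtain x where x: "x \<in> ball x0 \<rho>" "y = f x"
      by blast
    have "c * dist x x0 < c * r"
      using lower[OF x(1)] y x(2) by (simp add: dist_commute)
    then have "x \<in> ball x0 r"
      using \<open>c > 0\<close> by (simp add: dist_commute)
    with x(2) show "y \<in> f ` ball x0 r"
      by blast
  qed
  moreover have "\<delta> / c > 0"
    using \<open>\<delta> > 0\<close> \<open>c > 0\<close> by simp
  ultimately show ?thesis
    unfolding pointwise_co_lipschitz_at_def by blast
qed

lemma pointwise_imp_strongly_co_lipschitz_at:
  assumes "c > 0" and "locally_injective_at f x0" and "pointwise_co_lipschitz_at c f x0"
  shows "strongly_co_lipschitz_at c f x0"
proof -
  obtain r1 where "r1 > 0" and inj: "inj_on f (ball x0 r1)"
    using assms(2) by (auto simp: locally_injective_at_def)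
  obtain r0 where "r0 > 0"
    and incl: "\<And>r. r \<in> {0<..<r0} \<Longrightarrow> ball (f x0) (c * r) \<subseteq> f ` ball x0 r"
    using assms(3) by (auto simp: pointwise_co_lipschitz_at_def)
  \<comment> \<open>Halving makes \<open>\<rho>\<close> strictly smaller than \<open>r0\<close>, so that the inclusion holds at scale \<open>\<rho>\<close> itself
    and gives the interior condition.\<close>
  define \<rho> where "\<rho> = min r0 r1 / 2"
  have \<rho>: "0 < \<rho>" "\<rho> < r0" "\<rho> < r1"
    using \<open>r0 > 0\<close> \<open>r1 > 0\<close> by (auto simp: \<rho>_def)
  have "f x0 \<in> interior (f ` ball x0 \<rho>)"
    unfolding mem_interior using incl[of \<rho>] \<rho> \<open>c > 0\<close> by (intro exI[of _ "c * \<rho>"]) auto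
  moreover have "c * dist x x0 \<le> dist (f x) (f x0)" if x: "x \<in> ball x0 \<rho>" for x
  proof (rule ccontr)
    assume less: "\<not> c * dist x x0 \<le> dist (f x) (f x0)"
    then have "x \<noteq> x0"
      by auto
    then have "dist x x0 \<in> {0<..<r0}"
      using x \<rho> by (simp add: dist_commute)
    moreover have "f x \<in> ball (f x0) (c * dist x x0)"
      using less by (simp add: dist_commute)
    ultimately obtain x' where x': "x' \<in> ball x0 (dist x x0)" "f x = f x'"
      using incl by blast
    have "x \<in> ball x0 r1" "x' \<in> ball x0 r1"
      using x x'(1) \<rho> by (auto simp: dist_commute)
    with inj x'(2) have "x = x'"
      by (auto dest: inj_onD)
    with x'(1) show False
      by (simp add: dist_commute)
  qed
  ultimately show ?thesis
    unfolding strongly_co_lipschitz_at_def using \<rho>(1) by blast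
qed

theorem corollary2p20:
  fixes f :: "'a::metric_space \<Rightarrow> 'b::metric_space" and x0 :: 'a and c :: real
  assumes "c > 0"
    and "locally_injective_at f x0"
  shows "strongly_co_lipschitz_at c f x0 \<longleftrightarrow> pointwise_co_lipschitz_at c f x0"
  using assms strongly_imp_pointwise_co_lipschitz_at pointwise_imp_strongly_co_lipschitz_at
  by blast

end
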